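(* Let $A:\mathbb{R}^p\rightrightarrows 2^{\mathbb{R}^p}$ and $B$ be maximally monotone, with $B:\mathbb{R}^p\to\mathbb{R}^p$ single-valued and $L$-Lipschitz continuous. Let $x^\star$ satisfy $0\in A(x^\star)+B(x^\star)$ (such a point is assumed to exist). Let $\gamma>0$ and $G_\gamma(x):=\gamma^{-1}\big(x-J_{\gamma A}(x-\gamma B(x))\big)$. Let $x_0\in\mathbb{R}^p$, $u_0:=x_0+\gamma B(x_0)$, and let $\{(x_k,y_k)\}$ be generated for $k\ge0$ by the implicit scheme $$y_k = x_k+\beta_k(u_0-x_k)-\eta_kG_\gamma(x_k)-\gamma B(y_k)+\gamma(1-\beta_k)B(x_k),$$ $$x_{k+1} = x_k+\beta_k(u_0-x_k)-\eta_kG_\gamma(y_k)-\gamma B(x_{k+1})+\gamma(1-\beta_k)B(x_k),$$ where, with $M:=\frac{(1+\gamma L)^2}{\gamma^2}$ and $0<\eta_0\le\frac{\gamma}{\sqrt{3}(1+\gamma L)}$, $$\beta_k:=\frac{1}{k+2},\qquad \eta_{k+1}:=\frac{\eta_k\beta_{k+1}(1-M\eta_k^2-\beta_k^2)}{(1-\beta_k)\beta_k(1-M\eta_k^2)}.$$ Then $\eta_*:=\lim_{k\to\infty}\eta_k>0$, and with $C_*:=\frac{(1+\gamma L)^2(\eta_0\eta_*+\gamma^2)}{\gamma^2\eta_*}$ we have $$\|G_\gamma(x_k)\|^2\le\frac{4C_*\|x_0-x^\star\|^2}{\eta_*(k+1)(k+2)},\qquad \sum_{i=0}^{k-1}(i+1)(i+2)\|G_\gamma(x_{i+1})-G_\gamma(x_i)\|^2\le\frac{C_*\|x_0-x^\star\|^2}{\gamma}.$$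 Consequently, $\|G_\gamma(x_{k+1})-G_\gamma(x_k)\|^2=o\left(\frac{1}{k^2}\right)$.
   Context: $\mathbb{R}^p$ carries the standard inner product and Euclidean norm $\|\cdot\|$. For a maximally monotone operator $T$ and $\gamma>0$, $J_{\gamma T}:=(\mathbb{I}+\gamma T)^{-1}$ is its resolvent, which is single-valued and defined on all of $\mathbb{R}^p$. The implicit scheme is well defined: with $u_k:=x_k+\gamma B(x_k)$ and $v_k:=y_k+\gamma B(y_k)$ it is equivalent to $v_k=u_k+\beta_k(u_0-u_k)-\eta_kG_\gamma(x_k)$, $y_k=J_{\gamma B}(v_k)$, $u_{k+1}=u_k+\beta_k(u_0-u_k)-\eta_kG_\gamma(y_k)$, $x_{k+1}=J_{\gamma B}(u_{k+1})$. $G_\gamma$ is called the forward-backward residual mapping; $G_\gamma(x)=0$ iff $0\in A(x)+B(x)$. *)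

theory Defs
  imports "HOL-Analysis.Analysis" "HOL-Library.Landau_Symbols"
begin

text \<open>Set-valued operators are functions into sets; \<^term>\<open>T x = {}\<close> outside the domain of \<^term>\<open>T\<close>.\<close>

definition monotone_operator :: "('a::real_inner \<Rightarrow> 'a set) \<Rightarrow> bool" where
  "monotone_operator T \<longleftrightarrow>
     (\<forall>x y. \<forall>u\<in>T x. \<forall>v\<in>T y. (u - v) \<bullet> (x - y) \<ge> 0)"

definition maximally_monotone :: "('a::real_inner \<Rightarrow> 'a set) \<Rightarrow> bool" where
  "maximally_monotone T \<longleftrightarrow>
     monotone_operator T \<and>
     (\<forall>S. monotone_operator S \<and> (\<forall>x. T x \<subseteq> S x) \<longrightarrow> S = T)"

text \<open>\<open>J\<^bsub>\<gamma>T\<^esub> = (I + \<gamma>T)\<inverse>\<close>. The description operator is meaningful for maximally monotone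
  operators on a finite-dimensional space and \<open>\<gamma> > 0\<close>, where this inverse is single-valued
  with full domain (Minty).\<close>

definition resolvent :: "real \<Rightarrow> ('a::real_inner \<Rightarrow> 'a set) \<Rightarrow> 'a \<Rightarrow> 'a" where
  "resolvent \<gamma> T z = (THE x. z \<in> {x + \<gamma> *\<^sub>R w | w. w \<in> T x})"

definition fb_residual ::
    "real \<Rightarrow> ('a::real_inner \<Rightarrow> 'a set) \<Rightarrow> ('a \<Rightarrow> 'a) \<Rightarrow> 'a \<Rightarrow> 'a" where
  "fb_residual \<gamma> A B x = inverse \<gamma> *\<^sub>R (x - resolvent \<gamma> A (x - \<gamma> *\<^sub>R B x))"

end

theory Submission imports Defs begin

text \<open>Put \<open>U x = x + \<gamma> B x\<close>. As a function of \<open>U x\<close>, the residual \<open>G x\<close> is the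
  Douglas--Rachford residual, hence \<open>\<gamma>\<close>-cocoercive, and the scheme becomes the anchored
  extragradient method for it. The energy
  \<open>V\<^sub>k = (k+1)(k+2) \<eta>\<^sub>k \<parallel>G x\<^sub>k\<parallel>\<^sup>2/2 + (k+1) (G x\<^sub>k \<bullet> (U x\<^sub>k - u\<^sub>0))\<close>
  then satisfies \<open>V\<^sub>k\<^sub>+\<^sub>1 + \<gamma>(k+1)(k+2)\<parallel>G x\<^sub>k\<^sub>+\<^sub>1 - G x\<^sub>k\<parallel>\<^sup>2 \<le> V\<^sub>k\<close>, and Young's inequality bounds it below by
  \<open>\<eta>\<^sub>*(k+1)(k+2)\<parallel>G x\<^sub>k\<parallel>\<^sup>2/4 - \<parallel>u\<^sub>0 - U x\<^sup>\<star>\<parallel>\<^sup>2/\<eta>\<^sub>*\<close>. That the resolvent is defined everywhere is Minty's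
  theorem, proved by compactness from its finite case.\<close>

section \<open>Maximal monotonicity and surjectivity of \<open>I + \<gamma>A\<close>\<close>

text \<open>Adjoining \<open>w0\<close> to \<open>A x0\<close> keeps the operator monotone, so by
  maximality nothing was added.\<close>

lemma maximally_monotone_memI:
  assumes "maximally_monotone A"
    and rel: "\<And>a w. w \<in> A a \<Longrightarrow> (w0 - w) \<bullet> (x0 - a) \<ge> 0"
  shows "w0 \<in> A x0"
proof -
  have mono: "(u - v) \<bullet> (x - y) \<ge> 0" if "u \<in> A x" "v \<in> A y" for u v x y
    using assms(1) that unfolding maximally_monotone_def monotone_operator_def by blast
  define S where "S = A(x0 := insert w0 (A x0))"
  have rel': "(w - w0) \<bullet> (a - x0) \<ge> 0" if "w \<in> A a" for a w
    using rel[OF that] by (simp add: inner_diff_left inner_diff_right)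
  have "monotone_operator S"
    unfolding monotone_operator_def S_def using mono rel rel' by (auto split: if_splits)
  moreover have "\<forall>x. A x \<subseteq> S x"
    by (auto simp: S_def)
  ultimately have "S = A"
    using assms(1) unfolding maximally_monotone_def by blast
  then show ?thesis
    by (metis S_def fun_upd_same insertI1)
qed

text \<open>If every \<open>x\<close> failed, weighting each \<open>a\<close> by how much its inequality fails at \<open>x\<close> would give a
  continuous self-map of the convex hull; at a Brouwer fixed point the weighted failures sum to
  something nonpositive by monotonicity.\<close>

lemma Debrunner_Flor_finite:
  fixes F :: "('a::euclidean_space \<times> 'a) set" and z :: 'a
  assumes "finite F"
    and mono: "\<And>a w b v. (a, w) \<in> F \<Longrightarrow> (b, v) \<in> F \<Longrightarrow> (w - v) \<bullet> (a - b) \<ge> 0"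
    and "\<gamma> > 0"
  shows "\<exists>x. \<forall>(a, w)\<in>F. (z - x - \<gamma> *\<^sub>R w) \<bullet> (x - a) \<ge> 0"
proof (rule ccontr)
  assume neg: "\<nexists>x. \<forall>(a, w)\<in>F. (z - x - \<gamma> *\<^sub>R w) \<bullet> (x - a) \<ge> 0"
  define h where "h x = (\<lambda>i. (x + \<gamma> *\<^sub>R snd i - z) \<bullet> (x - fst i))" for x
  define \<mu> where "\<mu> x i = max 0 (h x i)" for x i
  define s where "s x = (\<Sum>i\<in>F. \<mu> x i)" for x
  define K where "K = convex hull (fst ` F)"
  define f where "f x = (\<Sum>i\<in>F. (\<mu> x i / s x) *\<^sub>R fst i)" for x
  have nonneg: "\<mu> x i \<ge> 0" for x i
    by (simp add: \<mu>_def)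
  have ex: "\<exists>i\<in>F. h x i > 0" for x
  proof -
    obtain a w where "(a, w) \<in> F" "(z - x - \<gamma> *\<^sub>R w) \<bullet> (x - a) < 0"
      using neg by (force simp: not_le split: prod.splits)
    moreover have "h x (a, w) = - ((z - x - \<gamma> *\<^sub>R w) \<bullet> (x - a))"
      by (simp add: h_def inner_diff_left inner_add_left)
    ultimately show ?thesis by force
  qed
  have s_pos: "s x > 0" for x
  proof -
    obtain i where "i \<in> F" "h x i > 0" using ex by blast
    then show ?thesis
      unfolding s_def using nonneg \<open>finite F\<close> by (intro sum_pos2[of _ i]) (auto simp: \<mu>_def)
  qed
  have "compact K" "convex K"
    unfolding K_def using \<open>finite F\<close> by (auto intro: compact_convex_hull finite_imp_compact)
  moreover have "K \<noteq> {}"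
    using ex unfolding K_def by auto
  moreover have "continuous_on K f"
    unfolding f_def s_def \<mu>_def h_def
    by (intro continuous_intros)
       (use s_pos in \<open>simp add: s_def \<mu>_def h_def less_imp_neq[symmetric]\<close>)
  moreover have "f \<in> K \<rightarrow> K"
  proof
    fix x
    have "(\<Sum>i\<in>F. \<mu> x i / s x) = 1"
      using s_pos[of x] by (simp add: s_def flip: sum_divide_distrib)
    then show "f x \<in> K"
      unfolding f_def K_def using \<open>finite F\<close> nonneg s_pos[of x]
      by (intro convex_sum) (auto simp: less_imp_le intro!: hull_inc)
  qed
  ultimately obtain x where x: "f x = x"
    using brouwer by metis
  define l where "l i = \<mu> x i / s x" for i
  have l_nonneg: "l i \<ge> 0" for i
    using nonneg s_pos[of x] by (simp add: l_def less_imp_le)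
  have l_sum: "(\<Sum>i\<in>F. l i) = 1"
    using s_pos[of x] by (simp add: l_def s_def flip: sum_divide_distrib)
  have x_eq: "x = (\<Sum>i\<in>F. l i *\<^sub>R fst i)"
    using x by (simp add: f_def l_def)
  \<comment> \<open>At the fixed point the weighted displacements cancel, which removes the only
    term containing \<open>z\<close> from the sum of failures.\<close>
  have centre: "(\<Sum>i\<in>F. l i *\<^sub>R (x - fst i)) = 0"
    using x_eq l_sum by (simp add: scaleR_diff_right sum_subtractf flip: scaleR_left.sum)
  have diff: "x - fst i = (\<Sum>j\<in>F. l j *\<^sub>R (fst j - fst i))" for i
    using x_eq l_sum by (simp add: scaleR_diff_right sum_subtractf flip: scaleR_left.sum)
  define T where "T = (\<Sum>i\<in>F. \<Sum>j\<in>F. l i * l j * (snd i \<bullet> (fst j - fst i)))"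
  obtain i0 where i0: "i0 \<in> F" "h x i0 > 0"
    using ex by blast
  have "0 < (\<Sum>i\<in>F. l i * h x i)"
  proof (rule sum_pos2[OF \<open>finite F\<close> i0(1)])
    show "0 < l i0 * h x i0"
      using i0 s_pos[of x] by (simp add: l_def \<mu>_def)
    show "0 \<le> l i * h x i" for i
      using s_pos[of x] by (cases "h x i \<ge> 0") (auto simp: l_def \<mu>_def less_imp_le)
  qed
  also have "(\<Sum>i\<in>F. l i * h x i)
      = (x - z) \<bullet> (\<Sum>i\<in>F. l i *\<^sub>R (x - fst i)) + \<gamma> * (\<Sum>i\<in>F. l i * (snd i \<bullet> (x - fst i)))"
    by (simp add: h_def inner_sum_right sum_distrib_left flip: sum.distrib)
       (rule sum.cong, auto simp: inner_diff_left inner_add_left algebra_simps)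
  also have "\<dots> = \<gamma> * T"
    unfolding centre T_def by (subst diff) (simp add: inner_sum_right sum_distrib_left mult.assoc)
  finally have "T > 0"
    using \<open>\<gamma> > 0\<close> by (simp add: zero_less_mult_iff)
  \<comment> \<open>Exchanging \<open>i\<close> and \<open>j\<close> and adding the two forms of
    \<open>T\<close> produces the monotonicity products with a minus sign.\<close>
  have "T = (\<Sum>i\<in>F. \<Sum>j\<in>F. l i * l j * (snd j \<bullet> (fst i - fst j)))"
    unfolding T_def by (subst sum.swap) (simp add: mult.commute)
  then have "T + T = (\<Sum>i\<in>F. \<Sum>j\<in>F. - (l i * l j * ((snd i - snd j) \<bullet> (fst i - fst j))))"
    by (subst (1) T_def)
       (simp add: inner_diff_left inner_diff_right algebra_simps flip: sum.distrib)
  also have "\<dots> \<le> 0"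
    using mono l_nonneg by (intro sum_nonpos) (auto intro!: mult_nonneg_nonneg)
  finally show False
    using \<open>T > 0\<close> by simp
qed

text \<open>Each graph point \<open>(a, w)\<close> confines \<open>x\<close> to the compact set
  \<open>C (a, w)\<close>, and the finite case gives these sets the finite intersection property.
  For a common point \<open>x\<close>, the vector \<open>inverse \<gamma> *\<^sub>R (z - x)\<close>
  is monotonically related to the whole graph, so maximality puts it into
  \<open>A x\<close>.\<close>

lemma Minty:
  fixes A :: "'a::euclidean_space \<Rightarrow> 'a set"
  assumes max: "maximally_monotone A" and "\<gamma> > 0"
  shows "\<exists>x. inverse \<gamma> *\<^sub>R (z - x) \<in> A x"
proof -
  define C where "C = (\<lambda>(a, w). {x. (z - x - \<gamma> *\<^sub>R w) \<bullet> (x - a) \<ge> 0})"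
  define Gr where "Gr = {(a, w). w \<in> A a}"
  have mono: "(u - v) \<bullet> (x - y) \<ge> 0" if "u \<in> A x" "v \<in> A y" for u v x y
    using max that unfolding maximally_monotone_def monotone_operator_def by blast
  have compact: "compact (C i)" for i
  proof -
    obtain a w where i: "i = (a, w)" by fastforce
    \<comment> \<open>Split \<open>z - x - \<gamma> *\<^sub>R w\<close> as
      \<open>(z - a - \<gamma> *\<^sub>R w) - (x - a)\<close>; Cauchy-Schwarz then bounds
      \<open>norm (x - a)\<close>.\<close>
    have "C i \<subseteq> cball a (norm (z - a - \<gamma> *\<^sub>R w))"
    proof
      fix x assume "x \<in> C i"
      then have "(x - a) \<bullet> (x - a) \<le> (z - a - \<gamma> *\<^sub>R w) \<bullet> (x - a)"
        by (simp add: C_def i inner_diff_left)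
      also have "\<dots> \<le> norm (z - a - \<gamma> *\<^sub>R w) * norm (x - a)"
        by (rule norm_cauchy_schwarz)
      finally have "norm (x - a) * norm (x - a) \<le> norm (z - a - \<gamma> *\<^sub>R w) * norm (x - a)"
        by (simp add: dot_square_norm power2_eq_square)
      then have "norm (x - a) \<le> norm (z - a - \<gamma> *\<^sub>R w)"
        by (cases "x = a") auto
      then show "x \<in> cball a (norm (z - a - \<gamma> *\<^sub>R w))"
        by (simp add: dist_norm norm_minus_commute)
    qed
    moreover have "closed (C i)"
      unfolding C_def i prod.case by (intro closed_Collect_le continuous_intros)
    ultimately show ?thesis
      using bounded_cball bounded_subset compact_eq_bounded_closed by blast
  qed
  have "\<exists>x. \<forall>i\<in>Gr. x \<in> C i"
  proof (cases "Gr = {}")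
    case False
    have "\<Inter>(C ` Gr) \<noteq> {}"
    proof (rule compact_fip_Heine_Borel)
      show "compact T" if "T \<in> C ` Gr" for T
        using that compact by blast
      fix \<F> assume "finite \<F>" "\<F> \<subseteq> C ` Gr"
      then obtain F where F: "finite F" "F \<subseteq> Gr" "\<F> = C ` F"
        by (meson finite_subset_image)
      obtain x where "\<forall>(a, w)\<in>F. (z - x - \<gamma> *\<^sub>R w) \<bullet> (x - a) \<ge> 0"
        using Debrunner_Flor_finite[OF F(1) _ \<open>\<gamma> > 0\<close>, of z] F(2) mono unfolding Gr_def by blast
      then have "x \<in> \<Inter>\<F>"
        unfolding F(3) C_def by auto
      then show "\<Inter>\<F> \<noteq> {}" by blast
    qed
    then show ?thesis by blast
  qed auto
  then obtain x where x: "\<And>i. i \<in> Gr \<Longrightarrow> x \<in> C i" by blast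
  have "inverse \<gamma> *\<^sub>R (z - x) \<in> A x"
  proof (rule maximally_monotone_memI[OF max])
    fix a w assume "w \<in> A a"
    then have "(z - x - \<gamma> *\<^sub>R w) \<bullet> (x - a) \<ge> 0"
      using x[of "(a, w)"] by (simp add: Gr_def C_def)
    moreover have "inverse \<gamma> *\<^sub>R (z - x) - w = inverse \<gamma> *\<^sub>R (z - x - \<gamma> *\<^sub>R w)"
      using \<open>\<gamma> > 0\<close> by (simp add: scaleR_diff_right)
    ultimately show "(inverse \<gamma> *\<^sub>R (z - x) - w) \<bullet> (x - a) \<ge> 0"
      using \<open>\<gamma> > 0\<close> by simp
  qed
  then show ?thesis by blast
qed

section \<open>Resolvent and forward-backward residual\<close>

text \<open>Monotonicity makes the preimage unique: for two candidates the operator values differ by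
  \<open>inverse \<gamma> *\<^sub>R (y - x)\<close>, whose product with \<open>x - y\<close> is
  nonnegative only if \<open>x = y\<close>. Thus the description operator returns
  \<open>x\<close>.\<close>

lemma resolvent_eqI:
  assumes "monotone_operator A" "\<gamma> > 0" "inverse \<gamma> *\<^sub>R (z - x) \<in> A x"
  shows "resolvent \<gamma> A z = x"
  unfolding resolvent_def
proof (rule the_equality)
  show "z \<in> {x + \<gamma> *\<^sub>R w |w. w \<in> A x}"
    using assms by (intro CollectI exI[of _ "inverse \<gamma> *\<^sub>R (z - x)"]) simp
next
  fix y assume "z \<in> {y + \<gamma> *\<^sub>R w |w. w \<in> A y}"
  then obtain w where w: "w \<in> A y" "z = y + \<gamma> *\<^sub>R w" by blast
  then have "w = inverse \<gamma> *\<^sub>R (z - y)"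
    using assms(2) by simp
  then have "inverse \<gamma> *\<^sub>R (z - x) - w = inverse \<gamma> *\<^sub>R (y - x)"
    by (simp flip: scaleR_diff_right)
  moreover have "(inverse \<gamma> *\<^sub>R (z - x) - w) \<bullet> (x - y) \<ge> 0"
    using assms(1,3) w(1) unfolding monotone_operator_def by blast
  ultimately have "(y - x) \<bullet> (x - y) \<ge> 0"
    using assms(2) by (simp add: zero_le_mult_iff)
  then have "(x - y) \<bullet> (x - y) \<le> 0"
    by (simp add: inner_diff_left)
  then show "y = x"
    by (metis eq_iff_diff_eq_0 inner_eq_zero_iff inner_ge_zero order_antisym)
qed

lemma resolvent_mem:
  fixes A :: "'a::euclidean_space \<Rightarrow> 'a set"
  assumes "maximally_monotone A" "\<gamma> > 0"
  shows "inverse \<gamma> *\<^sub>R (z - resolvent \<gamma> A z) \<in> A (resolvent \<gamma> A z)"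
  using Minty[OF assms, of z] resolvent_eqI[of A \<gamma> z] assms
  unfolding maximally_monotone_def by metis

lemma fb_residual_eq_0:
  assumes "monotone_operator A" "\<gamma> > 0" "- B x \<in> A x"
  shows "fb_residual \<gamma> A B x = 0"
  unfolding fb_residual_def using assms by (subst resolvent_eqI[of A \<gamma> _ x]) auto

text \<open>Since \<open>G x - B x\<close> lies in \<open>A (x - \<gamma> *\<^sub>R G x)\<close>,
  monotonicity of \<open>A\<close> at two such points can be added to that of \<open>B\<close> at
  \<open>x\<close> and \<open>y\<close>. The mixed product of \<open>G\<close> and \<open>B\<close>
  differences that remains turns \<open>x - y\<close> into the difference of the shifted
  points.\<close>

lemma fb_residual_cocoercive:
  fixes A :: "'a::euclidean_space \<Rightarrow> 'a set"
  assumes "maximally_monotone A" "\<gamma> > 0" "monotone_operator (\<lambda>z. {B z})"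
  shows "\<gamma> * (norm (fb_residual \<gamma> A B x - fb_residual \<gamma> A B y))\<^sup>2
    \<le> (fb_residual \<gamma> A B x - fb_residual \<gamma> A B y) \<bullet> ((x + \<gamma> *\<^sub>R B x) - (y + \<gamma> *\<^sub>R B y))"
proof -
  define G where "G = fb_residual \<gamma> A B"
  have res: "resolvent \<gamma> A (x - \<gamma> *\<^sub>R B x) = x - \<gamma> *\<^sub>R G x" for x
    using assms(2) by (simp add: G_def fb_residual_def)
  have "G x - B x \<in> A (x - \<gamma> *\<^sub>R G x)" for x
    using resolvent_mem[OF assms(1,2), of "x - \<gamma> *\<^sub>R B x"] assms(2)
    unfolding res by (simp add: scaleR_diff_right)
  then have "((G x - B x) - (G y - B y)) \<bullet> ((x - \<gamma> *\<^sub>R G x) - (y - \<gamma> *\<^sub>R G y)) \<ge> 0"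
    using assms(1) unfolding maximally_monotone_def monotone_operator_def by blast
  moreover have "(B x - B y) \<bullet> (x - y) \<ge> 0"
    using assms(3) unfolding monotone_operator_def by blast
  ultimately show ?thesis
    unfolding G_def[symmetric] power2_norm_eq_inner
    by (simp add: inner_diff_left inner_diff_right inner_add_left inner_add_right
        inner_commute algebra_simps)
qed

section \<open>Step sizes\<close>

text \<open>The sequence decreases, and its factors are at least
  \<open>1 - 1 / (k+2)\<^sup>2\<close>. Their product telescopes to
  \<open>(k+2) / (2 * (k+1))\<close>, the lower bound carried through the induction, which never
  falls below one half. The bound on \<open>M * (\<eta> k)\<^sup>2\<close> is carried along because
  \<open>step\<close> is available only under it.\<close>

lemma eag_stepsize_limit:
  fixes \<eta> :: "nat \<Rightarrow> real"
  assumes "M \<ge> 0" and eta0: "\<eta> 0 > 0" and small: "M * (\<eta> 0)\<^sup>2 \<le> 1/3"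
    and step: "\<And>k. M * (\<eta> k)\<^sup>2 \<le> 1/3 \<Longrightarrow> \<eta> (Suc k) = \<eta> k * (1 - M * (\<eta> k)\<^sup>2
                  / ((1 - M * (\<eta> k)\<^sup>2) * ((real k + 1) * (real k + 3))))"
  obtains l where "\<eta> \<longlonglongrightarrow> l" "l > 0" "\<And>k. l \<le> \<eta> k" "\<And>k. M * (\<eta> k)\<^sup>2 \<le> 1/3"
proof -
  have inv: "\<eta> 0 * ((real k + 2) / (2 * (real k + 1))) \<le> \<eta> k \<and> \<eta> k \<le> \<eta> 0
      \<and> M * (\<eta> k)\<^sup>2 \<le> 1/3 \<and> \<eta> (Suc k) \<le> \<eta> k" for k
  proof (induction k)
    case 0
    have "M * (\<eta> 0)\<^sup>2 / ((1 - M * (\<eta> 0)\<^sup>2) * 3) \<ge> 0"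
      using \<open>M \<ge> 0\<close> small by (intro divide_nonneg_nonneg) auto
    then show ?case
      using eta0 small by (auto simp: step[OF small] mult_le_cancel_left1)
  next
    case (Suc k)
    let ?n = "real k"
    define m where "m = M * (\<eta> k)\<^sup>2"
    define d where "d = (?n + 1) * (?n + 3)"
    have m: "0 \<le> m" "m \<le> 1/3"
      using Suc \<open>M \<ge> 0\<close> by (auto simp: m_def)
    have d: "d > 0" by (simp add: d_def)
    have low: "0 < \<eta> 0 * ((?n + 2) / (2 * (?n + 1)))"
      using eta0 by simp
    have pos: "\<eta> k > 0"
      using Suc low by linarith
    \<comment> \<open>Here the threshold 1/3 enters: it gives
      \<open>m / (1 - m) \<le> 1/2\<close>.\<close>
    have "m / ((1 - m) * d) \<le> 1 / (2 * d)"
      using m d by (simp add: field_simps)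
    also have "(?n + 2)\<^sup>2 \<le> 2 * d"
      by (simp add: d_def power2_eq_square algebra_simps)
    then have "1 / (2 * d) \<le> 1 / (?n + 2)\<^sup>2"
      by (intro frac_le) auto
    finally have frac: "m / ((1 - m) * d) \<le> 1 / (?n + 2)\<^sup>2" .
    have "\<eta> 0 * ((?n + 3) / (2 * (?n + 2)))
        = \<eta> 0 * ((?n + 2) / (2 * (?n + 1))) * (1 - 1 / (?n + 2)\<^sup>2)"
      by (simp add: divide_simps power2_eq_square) (simp add: algebra_simps)
    also have "\<dots> \<le> \<eta> k * (1 - m / ((1 - m) * d))"
    proof (intro mult_mono)
      have "1 / (?n + 2)\<^sup>2 \<le> 1"
        by simp
      then show "0 \<le> 1 - 1 / (?n + 2)\<^sup>2"
        by linarith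
    qed (use Suc frac pos in auto)
    also have "\<dots> = \<eta> (Suc k)"
      using Suc by (simp add: step m_def d_def)
    finally have lower: "\<eta> 0 * ((?n + 3) / (2 * (?n + 2))) \<le> \<eta> (Suc k)" .
    moreover have "0 < \<eta> 0 * ((?n + 3) / (2 * (?n + 2)))"
      using eta0 by simp
    ultimately have pos': "\<eta> (Suc k) > 0" by linarith
    have "M * (\<eta> (Suc k))\<^sup>2 \<le> M * (\<eta> k)\<^sup>2"
      using Suc pos' \<open>M \<ge> 0\<close> by (intro mult_left_mono power_mono) auto
    then have m': "M * (\<eta> (Suc k))\<^sup>2 \<le> 1/3"
      using Suc by linarith
    have "M * (\<eta> (Suc k))\<^sup>2 / ((1 - M * (\<eta> (Suc k))\<^sup>2) * ((real (Suc k) + 1) * (real (Suc k) + 3))) \<ge> 0"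
      using \<open>M \<ge> 0\<close> m' by (intro divide_nonneg_nonneg mult_nonneg_nonneg) auto
    then have "\<eta> (Suc (Suc k)) \<le> \<eta> (Suc k)"
      using pos' by (subst step[OF m']) (simp add: mult_le_cancel_left1)
    then show ?case
      using lower m' Suc by (auto simp: add.commute)
  qed
  have half: "\<eta> 0 / 2 \<le> \<eta> k" for k
  proof -
    have "\<eta> 0 * (1 / 2) \<le> \<eta> 0 * ((real k + 2) / (2 * (real k + 1)))"
      using eta0 by (intro mult_left_mono) (auto simp: divide_simps)
    then show ?thesis
      using inv[of k] by linarith
  qed
  have "decseq \<eta>"
    using inv by (intro decseq_SucI) blast
  then obtain l where l: "\<eta> \<longlonglongrightarrow> l" "\<And>k. l \<le> \<eta> k"
    using half decseq_convergent by metis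
  moreover have "\<eta> 0 / 2 \<le> l"
    using half by (intro LIMSEQ_le_const[OF l(1)]) auto
  ultimately show thesis
    using that[of l] eta0 inv by auto
qed

section \<open>Energy descent in one step\<close>

text \<open>The step-size recursion is exactly what makes the quadratic form in \<open>(q, r)\<close> left over after
  subtracting the Lipschitz inequality a multiple of a square.\<close>

lemma eag_quadratic_form:
  fixes p q r :: "'a::real_inner"
  assumes "0 < m" "m < 1" "\<beta> < 1"
    and \<rho>: "\<rho> = (1 - m - \<beta>\<^sup>2) / ((1 - \<beta>)\<^sup>2 * (1 - m))"
    and lip: "(norm (r - q))\<^sup>2 \<le> m * (norm (q - p))\<^sup>2"
  shows "\<rho> * (norm r)\<^sup>2 \<le> (norm p)\<^sup>2 + 2 / (1 - \<beta>) * (r \<bullet> q) - 2 * (p \<bullet> q)"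
proof -
  define t where "t = 1 - \<beta>"
  have t: "t > 0" "\<beta> = 1 - t"
    using assms by (auto simp: t_def)
  \<comment> \<open>The choice of \<open>c\<close> gives \<open>r \<bullet> q\<close> the
    coefficient \<open>2 / t\<close>; by \<open>c2\<close> the coefficient of
    \<open>r \<bullet> r\<close> then becomes \<open>- \<rho>\<close>.\<close>
  define c where "c = (1 - m / t) / (1 - m)"
  have c1: "(1 - m) / m * c = 1 / m - 1 / t"
    using assms t by (simp add: c_def divide_simps)
  have c2: "(1 - m) / m * c\<^sup>2 = 1 / m - \<rho>"
    using assms(1,2) t(1) unfolding \<rho> c_def t(2)
    by (simp add: divide_simps power2_eq_square; simp add: algebra_simps)
  \<comment> \<open>The factor \<open>1 / m\<close> gives the \<open>p\<close> terms their required
    coefficients, and the weight \<open>(1 - m) / m\<close> of the square cancels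
    \<open>q \<bullet> q\<close>.\<close>
  have "0 \<le> 1 / m * (m * (norm (q - p))\<^sup>2 - (norm (r - q))\<^sup>2) + (1 - m) / m * (norm (q - c *\<^sub>R r))\<^sup>2"
    using assms by (intro add_nonneg_nonneg mult_nonneg_nonneg) auto
  also have "(norm (q - c *\<^sub>R r))\<^sup>2 = q \<bullet> q - 2 * c * (r \<bullet> q) + c\<^sup>2 * (r \<bullet> r)"
    unfolding power2_norm_eq_inner
    by (simp add: inner_diff_left inner_diff_right inner_commute power2_eq_square)
  also have "(1 - m) / m * \<dots> = (1 - m) / m * (q \<bullet> q) - 2 * ((1 - m) / m * c) * (r \<bullet> q)
      + ((1 - m) / m * c\<^sup>2) * (r \<bullet> r)"
    by (simp add: algebra_simps)
  also have "1 / m * (m * (norm (q - p))\<^sup>2 - (norm (r - q))\<^sup>2) + \<dots>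
      = p \<bullet> p + 2 / t * (r \<bullet> q) - 2 * (p \<bullet> q) - \<rho> * (r \<bullet> r)"
    unfolding c1 c2 using assms(1)
    by (simp add: power2_norm_eq_inner inner_diff_left inner_diff_right inner_commute
        field_simps)
  finally show ?thesis
    by (simp add: power2_norm_eq_inner t_def)
qed

text \<open>Here \<open>p\<close>, \<open>q\<close>, \<open>r\<close> stand for the residuals at the
  current, intermediate and next point. Cocoercivity divided by \<beta> pays for the term in
  \<open>r - p\<close>. In the sum with the quadratic-form bound the products of \<open>r\<close>
  with \<open>w\<close> and \<open>q\<close>, and of \<open>p\<close> with \<open>q\<close>, all
  cancel.\<close>

lemma eag_descent:
  fixes u0 u u' p q r :: "'a::real_inner"
  assumes "0 < m" "m < 1" "0 < \<beta>" "\<beta> < 1" "0 < \<eta>"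
    and \<rho>: "\<rho> = (1 - m - \<beta>\<^sup>2) / ((1 - \<beta>)\<^sup>2 * (1 - m))"
    and lip: "(norm (r - q))\<^sup>2 \<le> m * (norm (q - p))\<^sup>2"
    and u': "u' = u + \<beta> *\<^sub>R (u0 - u) - \<eta> *\<^sub>R q"
    and coco: "\<gamma> * (norm (r - p))\<^sup>2 \<le> (r - p) \<bullet> (u' - u)"
  shows "\<rho> * \<eta> / (2 * \<beta>) * (norm r)\<^sup>2 + 1 / (1 - \<beta>) * (r \<bullet> (u' - u0)) + \<gamma> / \<beta> * (norm (r - p))\<^sup>2
    \<le> \<eta> / (2 * \<beta>) * (norm p)\<^sup>2 + p \<bullet> (u - u0)"
proof -
  define w where "w = u - u0"
  have d: "u' - u = - (\<beta> *\<^sub>R w) - \<eta> *\<^sub>R q" "u' - u0 = (1 - \<beta>) *\<^sub>R w - \<eta> *\<^sub>R q"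
    unfolding u' w_def by (simp_all add: algebra_simps)
  have "\<rho> * \<eta> / (2 * \<beta>) * (norm r)\<^sup>2 = \<eta> / (2 * \<beta>) * (\<rho> * (norm r)\<^sup>2)"
    by simp
  also have "\<dots> \<le> \<eta> / (2 * \<beta>) * ((norm p)\<^sup>2 + 2 / (1 - \<beta>) * (r \<bullet> q) - 2 * (p \<bullet> q))"
    using assms by (intro mult_left_mono eag_quadratic_form[OF _ _ _ \<rho> lip]) auto
  finally have 1: "\<rho> * \<eta> / (2 * \<beta>) * (norm r)\<^sup>2
      \<le> \<eta> / (2 * \<beta>) * ((norm p)\<^sup>2 + 2 / (1 - \<beta>) * (r \<bullet> q) - 2 * (p \<bullet> q))" .
  have 2: "\<gamma> / \<beta> * (norm (r - p))\<^sup>2 \<le> 1 / \<beta> * ((r - p) \<bullet> (u' - u))"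
    using coco \<open>0 < \<beta>\<close> by (simp add: divide_right_mono)
  have 3: "\<eta> / (2 * \<beta>) * ((norm p)\<^sup>2 + 2 / (1 - \<beta>) * (r \<bullet> q) - 2 * (p \<bullet> q))
      + 1 / (1 - \<beta>) * (r \<bullet> (u' - u0)) + 1 / \<beta> * ((r - p) \<bullet> (u' - u))
      = \<eta> / (2 * \<beta>) * (norm p)\<^sup>2 + p \<bullet> w"
    using \<open>0 < \<beta>\<close> \<open>\<beta> < 1\<close> unfolding d
    by (simp add: inner_diff_left inner_diff_right divide_simps) (simp add: algebra_simps)
  show ?thesis
    using 1 2 3 unfolding w_def by linarith
qed

theorem theorem2:
  fixes A :: "real ^ 'p \<Rightarrow> (real ^ 'p) set"
    and B :: "real ^ 'p \<Rightarrow> real ^ 'p"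
    and L \<gamma> M :: real
    and xstar u0 :: "real ^ 'p"
    and x y :: "nat \<Rightarrow> real ^ 'p"
    and \<beta> \<eta> :: "nat \<Rightarrow> real"
    and G :: "real ^ 'p \<Rightarrow> real ^ 'p"
  assumes A_max: "maximally_monotone A"
    and B_max: "maximally_monotone (\<lambda>z. {B z})"
    and B_lip: "L-lipschitz_on UNIV B"
    and sol: "0 \<in> {a + B xstar | a. a \<in> A xstar}"
    and gamma_pos: "\<gamma> > 0"
    and G_eq: "G = fb_residual \<gamma> A B"
    and u0_eq: "u0 = x 0 + \<gamma> *\<^sub>R B (x 0)"
    and M_eq: "M = (1 + \<gamma> * L)\<^sup>2 / \<gamma>\<^sup>2"
    and beta_eq: "\<And>k. \<beta> k = 1 / (real k + 2)"
    and eta0_pos: "0 < \<eta> 0"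
    and eta0_le: "\<eta> 0 \<le> \<gamma> / (sqrt 3 * (1 + \<gamma> * L))"
    and eta_Suc: "\<And>k. \<eta> (Suc k) =
          \<eta> k * \<beta> (Suc k) * (1 - M * (\<eta> k)\<^sup>2 - (\<beta> k)\<^sup>2)
            / ((1 - \<beta> k) * \<beta> k * (1 - M * (\<eta> k)\<^sup>2))"
    and y_step: "\<And>k. y k =
          x k + \<beta> k *\<^sub>R (u0 - x k) - \<eta> k *\<^sub>R G (x k)
            - \<gamma> *\<^sub>R B (y k) + (\<gamma> * (1 - \<beta> k)) *\<^sub>R B (x k)"
    and x_step: "\<And>k. x (Suc k) =
          x k + \<beta> k *\<^sub>R (u0 - x k) - \<eta> k *\<^sub>R G (y k)
            - \<gamma> *\<^sub>R B (x (Suc k)) + (\<gamma> * (1 - \<beta> k)) *\<^sub>R B (x k)"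
  shows "\<exists>\<eta>s C. \<eta> \<longlonglongrightarrow> \<eta>s \<and> \<eta>s > 0
      \<and> C = (1 + \<gamma> * L)\<^sup>2 * (\<eta> 0 * \<eta>s + \<gamma>\<^sup>2) / (\<gamma>\<^sup>2 * \<eta>s)
      \<and> (\<forall>k. (norm (G (x k)))\<^sup>2
              \<le> 4 * C * (norm (x 0 - xstar))\<^sup>2 / (\<eta>s * (real k + 1) * (real k + 2)))
      \<and> (\<forall>k. (\<Sum>i<k. (real i + 1) * (real i + 2) * (norm (G (x (Suc i)) - G (x i)))\<^sup>2)
              \<le> C * (norm (x 0 - xstar))\<^sup>2 / \<gamma>)
      \<and> (\<lambda>k. (norm (G (x (Suc k)) - G (x k)))\<^sup>2) \<in> o(\<lambda>k. 1 / (real k)\<^sup>2)"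
proof -

  \<comment> \<open>Residual as a cocoercive function of the shifted point\<close>
  have L: "L \<ge> 0"
    using B_lip by (rule lipschitz_on_nonneg)
  have A_mono: "monotone_operator A" and B_mono: "monotone_operator (\<lambda>z. {B z})"
    using A_max B_max by (auto simp: maximally_monotone_def)
  define U where "U z = z + \<gamma> *\<^sub>R B z" for z
  have coco: "\<gamma> * (norm (G a - G b))\<^sup>2 \<le> (G a - G b) \<bullet> (U a - U b)" for a b
    unfolding U_def G_eq by (rule fb_residual_cocoercive[OF A_max gamma_pos B_mono])
  have G_lip: "norm (G a - G b) \<le> norm (U a - U b) / \<gamma>" for a b
  proof (cases "G a = G b")
    case False
    have "norm (G a - G b) * (\<gamma> * norm (G a - G b)) \<le> norm (G a - G b) * norm (U a - U b)"
      using coco[of a b] norm_cauchy_schwarz[of "G a - G b" "U a - U b"]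
      by (simp add: power2_eq_square mult_ac)
    then show ?thesis
      using False gamma_pos by (simp add: field_simps)
  qed (use gamma_pos in simp)
  have G_star: "G xstar = 0"
    unfolding G_eq using sol by (intro fb_residual_eq_0[OF A_mono gamma_pos])
      (auto simp: eq_neg_iff_add_eq_0[symmetric])
  define D where "D = (norm (x 0 - xstar))\<^sup>2"
  have U0: "U (x 0) = u0"
    by (simp add: U_def u0_eq)
  \<comment> \<open>The energy argument measures distance between shifted points; returning to
    \<open>x 0 - xstar\<close> costs \<open>1 + \<gamma> * L\<close>, the source of that factor in
    \<open>C\<close>.\<close>
  have d_le: "norm (u0 - U xstar) \<le> (1 + \<gamma> * L) * norm (x 0 - xstar)"
  proof -
    have "norm (u0 - U xstar) \<le> norm (x 0 - xstar) + norm (\<gamma> *\<^sub>R (B (x 0) - B xstar))"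
      unfolding u0_eq U_def
      by (rule order_trans[OF _ norm_triangle_ineq]) (simp add: algebra_simps)
    also have "norm (B (x 0) - B xstar) \<le> L * norm (x 0 - xstar)"
      using lipschitz_onD[OF B_lip, of "x 0" xstar] by (simp add: dist_norm)
    then have "norm (\<gamma> *\<^sub>R (B (x 0) - B xstar)) \<le> \<gamma> * (L * norm (x 0 - xstar))"
      using gamma_pos by simp
    finally show ?thesis by (simp add: algebra_simps)
  qed
  define E where "E = (norm (u0 - U xstar))\<^sup>2"
  have E_le: "E \<le> (1 + \<gamma> * L)\<^sup>2 * D"
    using power_mono[OF d_le norm_ge_zero, of 2] by (simp add: E_def D_def power_mult_distrib)

  \<comment> \<open>Constants and limit of the step sizes\<close>
  have M_ge: "1 / \<gamma>\<^sup>2 \<le> M"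
    unfolding M_eq using L gamma_pos by (intro divide_right_mono) auto
  then have M_pos: "M > 0"
    using gamma_pos by (meson less_le_trans zero_less_divide_1_iff zero_less_power)
  \<comment> \<open>The upper bound imposed on \<open>\<eta> 0\<close> is the value at which this
    product equals 1/3.\<close>
  have "M * (\<eta> 0)\<^sup>2 \<le> M * (\<gamma> / (sqrt 3 * (1 + \<gamma> * L)))\<^sup>2"
    using M_pos eta0_pos eta0_le by (intro mult_left_mono power_mono) auto
  also have "\<dots> = 1/3"
  proof -
    have "1 + \<gamma> * L > 0"
      using L gamma_pos by (simp add: add_pos_nonneg)
    then show ?thesis
      using gamma_pos unfolding M_eq by (simp add: power_mult_distrib power_divide)
  qed
  finally have small: "M * (\<eta> 0)\<^sup>2 \<le> 1/3" .
  have eta_Suc_ne: "\<eta> (Suc k) = \<eta> k * (1 - M * (\<eta> k)\<^sup>2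
      / ((1 - M * (\<eta> k)\<^sup>2) * ((real k + 1) * (real k + 3))))" if "M * (\<eta> k)\<^sup>2 \<noteq> 1" for k
  proof -
    define m where "m = M * (\<eta> k)\<^sup>2"
    define n where "n = real k"
    have nz: "1 - m \<noteq> 0" "n + 1 \<noteq> 0" "n + 2 \<noteq> 0" "n + 3 \<noteq> 0"
      using that by (auto simp: m_def n_def)
    have "\<eta> (Suc k) = \<eta> k * (1 / (n + 3)) * (1 - m - (1 / (n + 2))\<^sup>2)
        / ((1 - 1 / (n + 2)) * (1 / (n + 2)) * (1 - m))"
      unfolding eta_Suc[of k] beta_eq m_def n_def by (simp add: add_ac)
    also have "1 - 1 / (n + 2) = (n + 1) / (n + 2)"
      using nz by (simp add: field_simps)
    also have "\<eta> k * (1 / (n + 3)) * (1 - m - (1 / (n + 2))\<^sup>2) / ((n + 1) / (n + 2) * (1 / (n + 2)) * (1 - m))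
        = \<eta> k * (1 - m / ((1 - m) * ((n + 1) * (n + 3))))"
      using nz by (simp add: divide_simps power2_eq_square) (simp add: algebra_simps)
    finally show ?thesis
      by (simp add: m_def n_def)
  qed
  obtain l where l: "\<eta> \<longlonglongrightarrow> l" "l > 0" and l_le: "\<And>k. l \<le> \<eta> k"
    and m_le: "\<And>k. M * (\<eta> k)\<^sup>2 \<le> 1/3"
    by (rule eag_stepsize_limit[of M \<eta>])
       (use M_pos eta0_pos small eta_Suc_ne in \<open>auto simp: less_imp_le\<close>)
  have eta_pos: "\<eta> k > 0" for k
    using l(2) l_le[of k] by linarith

  \<comment> \<open>Energy and its decrease\<close>
  define V where "V k = (real k + 1) * (real k + 2) * \<eta> k / 2 * (norm (G (x k)))\<^sup>2
      + (real k + 1) * (G (x k) \<bullet> (U (x k) - u0))" for k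
  define \<Delta> where "\<Delta> k = (real k + 1) * (real k + 2) * (norm (G (x (Suc k)) - G (x k)))\<^sup>2" for k
  have descent: "V (Suc k) + \<gamma> * \<Delta> k \<le> V k" for k
  proof -
    define n where "n = real k"
    have n: "n \<ge> 0" by (simp add: n_def)
    have \<beta>k: "\<beta> k = 1 / (n + 2)" "\<beta> (Suc k) = 1 / (n + 3)"
      by (simp_all add: beta_eq n_def add_ac)
    have \<beta>: "0 < \<beta> k" "\<beta> k < 1" "1 - \<beta> k = (n + 1) / (n + 2)"
      using n by (simp_all add: \<beta>k field_simps)
    define m where "m = M * (\<eta> k)\<^sup>2"
    have m: "0 < m" "m < 1"
      using M_pos eta_pos[of k] m_le[of k] by (simp_all add: m_def)
    define \<rho> where "\<rho> = (1 - m - (\<beta> k)\<^sup>2) / ((1 - \<beta> k)\<^sup>2 * (1 - m))"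
    have Ux: "U (x (Suc k)) = U (x k) + \<beta> k *\<^sub>R (u0 - U (x k)) - \<eta> k *\<^sub>R G (y k)"
      using x_step[of k] unfolding U_def by (simp add: algebra_simps)
    have Uy: "U (y k) = U (x k) + \<beta> k *\<^sub>R (u0 - U (x k)) - \<eta> k *\<^sub>R G (x k)"
      using y_step[of k] unfolding U_def by (simp add: algebra_simps)
    have "norm (G (x (Suc k)) - G (y k)) \<le> norm (U (x (Suc k)) - U (y k)) / \<gamma>"
      by (rule G_lip)
    \<comment> \<open>Both updates share the same anchored point, so only the residual terms
      differ.\<close>
    also have "U (x (Suc k)) - U (y k) = - (\<eta> k *\<^sub>R (G (y k) - G (x k)))"
      unfolding Ux Uy by (simp add: algebra_simps)
    finally have "norm (G (x (Suc k)) - G (y k)) \<le> \<eta> k * norm (G (y k) - G (x k)) / \<gamma>"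
      using eta_pos[of k] by simp
    then have "(norm (G (x (Suc k)) - G (y k)))\<^sup>2 \<le> (\<eta> k * norm (G (y k) - G (x k)) / \<gamma>)\<^sup>2"
      by (intro power_mono) auto
    also have "\<dots> = 1 / \<gamma>\<^sup>2 * ((\<eta> k)\<^sup>2 * (norm (G (y k) - G (x k)))\<^sup>2)"
      by (simp add: power_divide power_mult_distrib)
    also have "\<dots> \<le> M * ((\<eta> k)\<^sup>2 * (norm (G (y k) - G (x k)))\<^sup>2)"
      by (intro mult_right_mono M_ge) auto
    finally have lip: "(norm (G (x (Suc k)) - G (y k)))\<^sup>2 \<le> m * (norm (G (y k) - G (x k)))\<^sup>2"
      by (simp add: m_def)
    have "\<rho> * \<eta> k / (2 * \<beta> k) * (norm (G (x (Suc k))))\<^sup>2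
        + 1 / (1 - \<beta> k) * (G (x (Suc k)) \<bullet> (U (x (Suc k)) - u0))
        + \<gamma> / \<beta> k * (norm (G (x (Suc k)) - G (x k)))\<^sup>2
      \<le> \<eta> k / (2 * \<beta> k) * (norm (G (x k)))\<^sup>2 + G (x k) \<bullet> (U (x k) - u0)" (is "?l \<le> ?r")
      by (rule eag_descent[OF m \<beta>(1,2) eta_pos \<rho>_def lip Ux coco])
    \<comment> \<open>The factor \<open>n + 1\<close> turns the right side into \<open>V k\<close>;
      divided by \<open>1 - \<beta> k\<close> it becomes \<open>n + 2\<close>, the weight of the
      anchor term in \<open>V (Suc k)\<close>.\<close>
    then have "(n + 1) * ?l \<le> (n + 1) * ?r"
      using n by (intro mult_left_mono) auto
    moreover have "(n + 1) * ?r = V k"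
      by (simp add: V_def \<beta>k flip: n_def) (simp add: algebra_simps)
    moreover have "(n + 1) * ?l = V (Suc k) + \<gamma> * \<Delta> k"
    proof -
      \<comment> \<open>In terms of \<open>\<rho>\<close>, the recursion is what makes the leading
        coefficient agree with that of \<open>V (Suc k)\<close>.\<close>
      have "\<eta> (Suc k) = \<rho> * \<eta> k * ((n + 1) / (n + 3))"
        unfolding eta_Suc[of k] m_def[symmetric] \<rho>_def \<beta>(3) \<beta>k(2)
        using n m by (simp add: \<beta>k(1) divide_simps power2_eq_square)
      then have "\<rho> * \<eta> k * (n + 1) = (n + 3) * \<eta> (Suc k)"
        using n by simp
      moreover have "(n + 1) * (\<rho> * \<eta> k / (2 * \<beta> k)) = (n + 2) / 2 * (\<rho> * \<eta> k * (n + 1))"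
        using n by (simp add: \<beta>k)
      ultimately have a: "(n + 1) * (\<rho> * \<eta> k / (2 * \<beta> k)) = (n + 2) * (n + 3) * \<eta> (Suc k) / 2"
        by simp
      have b: "(n + 1) * (1 / (1 - \<beta> k)) = n + 2"
        using n by (simp add: \<beta>(3))
      have c: "(n + 1) * (\<gamma> / \<beta> k) = \<gamma> * ((n + 1) * (n + 2))"
        by (simp add: \<beta>k)
      have "(n + 1) * ?l = (n + 1) * (\<rho> * \<eta> k / (2 * \<beta> k)) * (norm (G (x (Suc k))))\<^sup>2
        + (n + 1) * (1 / (1 - \<beta> k)) * (G (x (Suc k)) \<bullet> (U (x (Suc k)) - u0))
        + (n + 1) * (\<gamma> / \<beta> k) * (norm (G (x (Suc k)) - G (x k)))\<^sup>2"
        by (simp only: distrib_left mult.assoc)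
      also have "\<dots> = V (Suc k) + \<gamma> * \<Delta> k"
        unfolding a b c by (simp add: V_def \<Delta>_def n_def add_ac mult_ac)
      finally show ?thesis .
    qed
    ultimately show ?thesis by simp
  qed
  have telescope: "V k + \<gamma> * (\<Sum>i<k. \<Delta> i) \<le> V 0" for k
  proof (induction k)
    case (Suc k)
    then show ?case
      using descent[of k] by (simp add: distrib_left)
  qed simp

  \<comment> \<open>Bounds on the energy from both sides\<close>
  have V0: "V 0 \<le> \<eta> 0 / \<gamma>\<^sup>2 * E"
  proof -
    have "(norm (G (x 0)))\<^sup>2 \<le> (norm (u0 - U xstar) / \<gamma>)\<^sup>2"
      using G_lip[of "x 0" xstar] by (intro power_mono) (auto simp: G_star U0)
    then have "\<eta> 0 * (norm (G (x 0)))\<^sup>2 \<le> \<eta> 0 * (E / \<gamma>\<^sup>2)"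
      using eta0_pos unfolding power_divide E_def by (intro mult_left_mono) auto
    then show ?thesis
      by (simp add: V_def U0)
  qed
  have V_ge: "l * ((real k + 1) * (real k + 2)) / 4 * (norm (G (x k)))\<^sup>2 - E / l \<le> V k" for k
  proof -
    define n where "n = real k"
    have n: "n \<ge> 0" by (simp add: n_def)
    define g where "g = norm (G (x k))"
    define e where "e = norm (u0 - U xstar)"
    \<comment> \<open>Cocoercivity against the zero \<open>xstar\<close> lets \<open>U xstar\<close>
      replace \<open>U (x k)\<close> in the anchor term.\<close>
    have "G (x k) \<bullet> (U (x k) - U xstar) \<ge> 0"
      using coco[of "x k" xstar] gamma_pos
      by (simp add: G_star) (meson less_imp_le order_trans mult_nonneg_nonneg zero_le_power2)
    moreover have "G (x k) \<bullet> (u0 - U xstar) \<le> g * e"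
      unfolding g_def e_def by (rule norm_cauchy_schwarz)
    ultimately have "- (g * e) \<le> G (x k) \<bullet> (U (x k) - u0)"
      by (simp add: inner_diff_right)
    then have 1: "(n + 1) * - (g * e) \<le> (n + 1) * (G (x k) \<bullet> (U (x k) - u0))"
      using n by (intro mult_left_mono) auto
    have 2: "(n + 1) * (n + 2) * l / 2 * g\<^sup>2 \<le> (n + 1) * (n + 2) * \<eta> k / 2 * g\<^sup>2"
      using n l_le[of k] by (intro mult_right_mono divide_right_mono mult_left_mono) auto
    have "(n + 1) * (g * e) \<le> l * ((n + 1) * (n + 1)) / 4 * g\<^sup>2 + e\<^sup>2 / l"
    proof -
      \<comment> \<open>This weighting in Young's inequality consumes at most half of the quadratic
        term, so a quarter of \<open>l\<close> survives as its coefficient.\<close>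
      have "0 \<le> (l * (n + 1) * g / 2 - e)\<^sup>2 / l"
        using l(2) by simp
      also have "\<dots> = l * ((n + 1) * (n + 1)) / 4 * g\<^sup>2 + e\<^sup>2 / l - (n + 1) * (g * e)"
        using l(2) by (simp add: power2_eq_square divide_simps) (simp add: algebra_simps)
      finally show ?thesis by simp
    qed
    also have "l * ((n + 1) * (n + 1)) / 4 * g\<^sup>2 \<le> l * ((n + 1) * (n + 2)) / 4 * g\<^sup>2"
      using n l(2) by (intro mult_right_mono divide_right_mono mult_left_mono) auto
    finally have 3: "(n + 1) * (g * e) \<le> l * ((n + 1) * (n + 2)) / 4 * g\<^sup>2 + e\<^sup>2 / l"
      by simp
    have 4: "(n + 1) * (n + 2) * l / 2 * g\<^sup>2 = l * ((n + 1) * (n + 2)) / 4 * g\<^sup>2 + l * ((n + 1) * (n + 2)) / 4 * g\<^sup>2"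
      by simp
    have "V k = (n + 1) * (n + 2) * \<eta> k / 2 * g\<^sup>2 + (n + 1) * (G (x k) \<bullet> (U (x k) - u0))"
      by (simp add: V_def n_def g_def)
    then show ?thesis
      unfolding n_def[symmetric] g_def[symmetric] E_def e_def[symmetric]
      using 1 2 3 4 by linarith
  qed

  \<comment> \<open>Convergence rates\<close>
  define C where "C = (1 + \<gamma> * L)\<^sup>2 * (\<eta> 0 * l + \<gamma>\<^sup>2) / (\<gamma>\<^sup>2 * l)"
  \<comment> \<open>The two summands of \<open>C\<close> come from the initial energy and from the
    Young remainder.\<close>
  have CD: "\<eta> 0 / \<gamma>\<^sup>2 * E + E / l \<le> C * D"
  proof -
    have "\<eta> 0 / \<gamma>\<^sup>2 * E + E / l = (\<eta> 0 * l + \<gamma>\<^sup>2) / (\<gamma>\<^sup>2 * l) * E"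
      using l(2) gamma_pos by (simp add: field_simps)
    also have "\<dots> \<le> (\<eta> 0 * l + \<gamma>\<^sup>2) / (\<gamma>\<^sup>2 * l) * ((1 + \<gamma> * L)\<^sup>2 * D)"
      using E_le l(2) eta0_pos by (intro mult_left_mono) auto
    finally show ?thesis
      by (simp add: C_def mult_ac)
  qed
  have \<Delta>_nonneg: "\<Delta> k \<ge> 0" for k
    by (simp add: \<Delta>_def)
  \<comment> \<open>Both summands on the left are nonnegative; dropping either one gives one of the
    two claimed bounds.\<close>
  have energy: "l * ((real k + 1) * (real k + 2)) / 4 * (norm (G (x k)))\<^sup>2 + \<gamma> * (\<Sum>i<k. \<Delta> i) \<le> C * D" for k
    using telescope[of k] V0 V_ge[of k] CD by linarith
  have rate: "(norm (G (x k)))\<^sup>2 \<le> 4 * C * D / (l * (real k + 1) * (real k + 2))" for k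
  proof -
    have "\<gamma> * (\<Sum>i<k. \<Delta> i) \<ge> 0"
      using gamma_pos \<Delta>_nonneg by (simp add: sum_nonneg)
    then have "l * ((real k + 1) * (real k + 2)) / 4 * (norm (G (x k)))\<^sup>2 \<le> C * D"
      using energy[of k] by linarith
    then show ?thesis
      using l(2) by (simp add: pos_le_divide_eq mult_ac)
  qed
  have sum_bound: "(\<Sum>i<k. \<Delta> i) \<le> C * D / \<gamma>" for k
  proof -
    have "l * ((real k + 1) * (real k + 2)) / 4 * (norm (G (x k)))\<^sup>2 \<ge> 0"
      using l(2) by simp
    then show ?thesis
      using energy[of k] gamma_pos by (simp add: pos_le_divide_eq mult.commute)
  qed
  have "\<Delta> \<longlonglongrightarrow> 0"
    by (intro summable_LIMSEQ_zero summableI_nonneg_bounded[OF \<Delta>_nonneg sum_bound])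
  then have "(\<lambda>k. (norm (G (x (Suc k)) - G (x k)))\<^sup>2 * (real k)\<^sup>2) \<longlonglongrightarrow> 0"
  proof (rule Lim_null_comparison[rotated], intro always_eventually allI)
    fix k
    have "(real k)\<^sup>2 \<le> (real k + 1) * (real k + 2)"
      by (simp add: power2_eq_square algebra_simps)
    then show "norm ((norm (G (x (Suc k)) - G (x k)))\<^sup>2 * (real k)\<^sup>2) \<le> \<Delta> k"
      unfolding \<Delta>_def by (simp add: mult.commute[of _ "(real k)\<^sup>2"] mult_right_mono)
  qed
  \<comment> \<open>At \<open>k = 0\<close> the comparison function is 0 by the division convention,
    so nonvanishing is shown only eventually.\<close>
  then have "(\<lambda>k. (norm (G (x (Suc k)) - G (x k)))\<^sup>2) \<in> o(\<lambda>k. 1 / (real k)\<^sup>2)"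
    by (intro smalloI_tendsto) (auto intro: eventually_mono[OF eventually_gt_at_top[of 0]])
  then show ?thesis
    using l rate sum_bound C_def unfolding D_def \<Delta>_def by blast
qed

end
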